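(* Let $F$ be a forest. Then $\chi_{\mathrm{g}}(F)\le 3$ if there exists a vertex $b$ of $F$ such that, once $b$ becomes colored, every trunk $R'$ of the reduced graph $\mathcal{R}'(F)$ satisfies one of: (i) $R'$ has exactly one colored vertex and contains no edge of $E_{>>2}(\mathcal{R}'(F))$; or (ii) $R'$ has no colored vertices and there exists a vertex $v\in V(R')$ that covers $E_{>>2}(R')$.
   Context: $\chi_{\mathrm{g}}(G)$ is the least $t$ such that Alice has a winning strategy in the $t$-coloring game on $G$: Alice and Bob alternate turns, Alice first, coloring uncolored vertices with colors from a $t$-set so that no vertex gets a color used on a neighbor; Bob wins if some uncolored vertex has no available color, Alice wins if all vertices get colored. For a partially colored forest $F$, a trunk of $F$ is a maximal connected subgraph $R$ such that every colored vertex of $R$ is a leaf of $R$; $\mathcal{R}(F)$ is the partially colored forest formed by the disjoint union of all trunks of $F$ (a colored vertex lying in several trunks appears as a separate colored copy in each). For a graph $G$, $E_{>2}(G)$ is the set of edges $xy$ with $d_G(x)>2$ or $d_G(y)>2$, and $E_{>>2}(G)$ the set of edges $xy$ with $d_G(x)>2$ and $d_G(y)>2$. The reduced graph is $\mathcal{R}'(F)=\mathcal{R}(F)-\{xy: xy\notin E_{>2}(\mathcal{R}(F))\}$; its trunks are defined as for any partially colored forest. A vertex $v$ covers a set of edges if $v$ is an endpoint of every edge in the set. *)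

theory Defs
  imports Main
begin

text \<open>A (simple, finite) graph is a pair of a vertex set and a set of edges,
  each edge being a two-element set of vertices.\<close>

type_synonym 'a graph = "'a set \<times> 'a set set"

definition verts :: "'a graph \<Rightarrow> 'a set" where "verts G = fst G"
definition edges :: "'a graph \<Rightarrow> 'a set set" where "edges G = snd G"

definition graph :: "'a graph \<Rightarrow> bool" where
  "graph G \<longleftrightarrow> finite (verts G) \<and>
     (\<forall>e\<in>edges G. \<exists>x y. e = {x, y} \<and> x \<noteq> y \<and> x \<in> verts G \<and> y \<in> verts G)"

definition adj :: "'a graph \<Rightarrow> 'a \<Rightarrow> 'a \<Rightarrow> bool" where
  "adj G x y \<longleftrightarrow> {x, y} \<in> edges G \<and> x \<noteq> y"

definition deg :: "'a graph \<Rightarrow> 'a \<Rightarrow> nat" where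
  "deg G v = card {e \<in> edges G. v \<in> e}"

definition subgraph :: "'a graph \<Rightarrow> 'a graph \<Rightarrow> bool" where
  "subgraph H G \<longleftrightarrow> verts H \<subseteq> verts G \<and> edges H \<subseteq> edges G \<and> (\<forall>e\<in>edges H. e \<subseteq> verts H)"

definition connected :: "'a graph \<Rightarrow> bool" where
  "connected G \<longleftrightarrow> verts G \<noteq> {} \<and>
     (\<forall>x\<in>verts G. \<forall>y\<in>verts G. (x, y) \<in> {(a, b). adj G a b}\<^sup>*)"

definition is_cycle :: "'a graph \<Rightarrow> 'a list \<Rightarrow> bool" where
  "is_cycle G vs \<longleftrightarrow> length vs \<ge> 3 \<and> distinct vs \<and> set vs \<subseteq> verts G \<and>
     (\<forall>i. i + 1 < length vs \<longrightarrow> adj G (vs ! i) (vs ! (i + 1))) \<and> adj G (last vs) (hd vs)"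

definition forest :: "'a graph \<Rightarrow> bool" where
  "forest G \<longleftrightarrow> graph G \<and> \<not> (\<exists>vs. is_cycle G vs)"

section \<open>The coloring game\<close>

type_synonym 'a coloring = "'a \<Rightarrow> nat option"

definition legal_move :: "'a graph \<Rightarrow> nat \<Rightarrow> 'a coloring \<Rightarrow> 'a \<Rightarrow> nat \<Rightarrow> bool" where
  "legal_move G t c v k \<longleftrightarrow> v \<in> verts G \<and> c v = None \<and> k < t \<and>
     (\<forall>u. adj G u v \<longrightarrow> c u \<noteq> Some k)"

definition all_colored :: "'a graph \<Rightarrow> 'a coloring \<Rightarrow> bool" where
  "all_colored G c \<longleftrightarrow> (\<forall>v\<in>verts G. c v \<noteq> None)"

definition blocked :: "'a graph \<Rightarrow> nat \<Rightarrow> 'a coloring \<Rightarrow> bool" where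
  "blocked G t c \<longleftrightarrow> (\<exists>v\<in>verts G. c v = None \<and> (\<forall>k<t. \<exists>u. adj G u v \<and> c u = Some k))"

text \<open>\<open>alice_wins_from G t c turn\<close>: Alice has a winning strategy from position \<open>c\<close>,
  where \<open>turn = True\<close> means it is Alice's turn to move.\<close>

inductive alice_wins_from :: "'a graph \<Rightarrow> nat \<Rightarrow> 'a coloring \<Rightarrow> bool \<Rightarrow> bool"
  for G t where
  finished: "all_colored G c \<Longrightarrow> alice_wins_from G t c turn"
| alice: "\<not> all_colored G c \<Longrightarrow> \<not> blocked G t c \<Longrightarrow> legal_move G t c v k \<Longrightarrow>
          alice_wins_from G t (c(v := Some k)) False \<Longrightarrow> alice_wins_from G t c True"
| bob: "\<not> all_colored G c \<Longrightarrow> \<not> blocked G t c \<Longrightarrow>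
          (\<forall>v k. legal_move G t c v k \<longrightarrow> alice_wins_from G t (c(v := Some k)) True) \<Longrightarrow>
          alice_wins_from G t c False"

definition alice_wins :: "'a graph \<Rightarrow> nat \<Rightarrow> bool" where
  "alice_wins G t \<longleftrightarrow> alice_wins_from G t (\<lambda>_. None) True"

definition game_chromatic_number :: "'a graph \<Rightarrow> nat" where
  "game_chromatic_number G = (LEAST t. alice_wins G t)"

section \<open>Trunks and reduced graphs\<close>

text \<open>A partially colored graph is given by a graph \<open>G\<close> and the set \<open>C\<close> of colored vertices.\<close>

definition trunk_cond :: "'a graph \<Rightarrow> 'a set \<Rightarrow> 'a graph \<Rightarrow> bool" where
  "trunk_cond G C R \<longleftrightarrow> subgraph R G \<and> connected R \<and> (\<forall>v\<in>verts R \<inter> C. deg R v = 1)"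

definition trunk :: "'a graph \<Rightarrow> 'a set \<Rightarrow> 'a graph \<Rightarrow> bool" where
  "trunk G C R \<longleftrightarrow> trunk_cond G C R \<and>
     \<not> (\<exists>R'. R' \<noteq> R \<and> subgraph R R' \<and> trunk_cond G C R')"

text \<open>R(F): disjoint union of all trunks; vertex \<open>v\<close> of trunk \<open>R\<close> becomes \<open>(R, v)\<close>.\<close>

definition trunk_union :: "'a graph \<Rightarrow> 'a set \<Rightarrow> ('a graph \<times> 'a) graph" where
  "trunk_union G C =
     ({(R, v) | R v. trunk G C R \<and> v \<in> verts R},
      {{(R, u), (R, v)} | R u v. trunk G C R \<and> u \<noteq> v \<and> {u, v} \<in> edges R})"

definition trunk_union_col :: "'a graph \<Rightarrow> 'a set \<Rightarrow> ('a graph \<times> 'a) set" where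
  "trunk_union_col G C = {(R, v) | R v. trunk G C R \<and> v \<in> verts R \<and> v \<in> C}"

definition E_gt2 :: "'a graph \<Rightarrow> 'a set set" where
  "E_gt2 G = {e \<in> edges G. \<exists>x\<in>e. deg G x > 2}"

definition E_ggt2 :: "'a graph \<Rightarrow> 'a set set" where
  "E_ggt2 G = {e \<in> edges G. \<forall>x\<in>e. deg G x > 2}"

text \<open>R'(F): remove from R(F) all edges not in E_{>2}(R(F)); colored set is
  \<open>trunk_union_col\<close>.\<close>

definition reduced :: "'a graph \<Rightarrow> 'a set \<Rightarrow> ('a graph \<times> 'a) graph" where
  "reduced G C = (verts (trunk_union G C), E_gt2 (trunk_union G C))"

definition covers :: "'a \<Rightarrow> 'a set set \<Rightarrow> bool" where
  "covers v S \<longleftrightarrow> (\<forall>e\<in>S. v \<in> e)"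

end

theory Submission
  imports Defs
begin

text \<open>With three colours only the uncoloured vertices of degree at least 3 (high vertices) can
  become blocked, so edges between low vertices are irrelevant. Delete them together with the
  coloured vertices, and call an uncoloured high vertex touched by a colour if that colour occurs
  on a neighbour. Alice colours \<open>b\<close> and from then on keeps every component of what remains good: there is
  a centre \<open>v\<close> lying on all edges between high vertices, touches occur only at \<open>v\<close> and with a
  single colour, and a component with an edge between high vertices has no touch at all. As \<open>F\<close> is a
  forest, a vertex \<open>q\<close> newly coloured by Bob touches each component at most at one vertex \<open>z\<close>, and at
  most one component, containing the old centre \<open>v\<close>, stops being good. Usually colouring \<open>v\<close>
  repairs it. If the component has edges between high vertices and \<open>z \<noteq> v\<close>, Alice colours \<open>z\<close>
  when \<open>z\<close> and \<open>v\<close> are not adjacent; when they are, she gives \<open>v\<close> the colour of \<open>q\<close>, so that \<open>z\<close> sees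
  one colour twice.\<close>

section \<open>Forests\<close>

lemma adj_sym: "adj G x y \<Longrightarrow> adj G y x"
  by (auto simp: adj_def insert_commute)

lemma adj_neq: "adj G x y \<Longrightarrow> x \<noteq> y"
  by (simp add: adj_def)

lemma adj_verts:
  assumes "graph G" "adj G x y"
  shows "x \<in> verts G" "y \<in> verts G"
proof -
  have "{x, y} \<in> edges G" using assms(2) by (simp add: adj_def)
  with assms(1) obtain u v where "{x, y} = {u, v}" "u \<in> verts G" "v \<in> verts G"
    unfolding graph_def by blast
  then show "x \<in> verts G" "y \<in> verts G" by (auto simp: doubleton_eq_iff)
qed

lemma graph_edge_subset:
  assumes "graph G" "e \<in> edges G"
  shows "e \<subseteq> verts G"
proof -
  obtain x y where "e = {x, y}" "x \<in> verts G" "y \<in> verts G"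
    using assms unfolding graph_def by metis
  then show ?thesis by simp
qed

lemma graph_finite_edges:
  assumes "graph G"
  shows "finite (edges G)"
proof (rule finite_subset)
  show "edges G \<subseteq> Pow (verts G)" using graph_edge_subset[OF assms] by blast
  show "finite (Pow (verts G))" using assms by (simp add: graph_def)
qed

text \<open>Induction along the walk: if the next vertex already lies on the path, the path is cut
  back to that occurrence instead of being extended.\<close>

lemma rtranclp_distinct_path:
  assumes "r\<^sup>*\<^sup>* a b"
  shows "\<exists>xs. distinct xs \<and> xs \<noteq> [] \<and> hd xs = a \<and> last xs = b \<and> successively r xs"
  using assms
proof (induction rule: rtranclp_induct)
  case base
  show ?case by (rule exI[of _ "[a]"]) simp
next
  case (step b c)
  then obtain xs where xs: "distinct xs" "xs \<noteq> []" "hd xs = a" "last xs = b" "successively r xs"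
    by blast
  show ?case
  proof (cases "c \<in> set xs")
    case True
    then obtain ys zs where "xs = ys @ c # zs" by (meson split_list)
    then have eq: "xs = (ys @ [c]) @ zs" by simp
    show ?thesis
    proof (intro exI conjI)
      show "successively r (ys @ [c])" using xs(5) unfolding eq successively_append_iff by blast
      show "distinct (ys @ [c])" using xs(1) eq by simp
      show "hd (ys @ [c]) = a" using xs(3) eq by (cases ys) simp_all
    qed simp_all
  next
    case False
    with xs step show ?thesis
      by (intro exI[of _ "xs @ [c]"]) (auto simp: successively_append_iff)
  qed
qed

text \<open>A path from \<open>z\<close> to \<open>z'\<close> that avoids \<open>w\<close> would
  close up through \<open>w\<close> to a cycle. Acyclicity of \<open>F\<close> enters the whole
  proof only here.\<close>

lemma forest_neighbours_separated:
  assumes F: "forest F" and z: "adj F w z" and z': "adj F w z'"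
    and conn: "(\<lambda>x y. adj F x y \<and> x \<noteq> w \<and> y \<noteq> w)\<^sup>*\<^sup>* z z'"
  shows "z = z'"
proof (rule ccontr)
  assume ne: "z \<noteq> z'"
  have G: "graph F" using F by (simp add: forest_def)
  obtain xs where xs: "distinct xs" "xs \<noteq> []" "hd xs = z" "last xs = z'"
    "successively (\<lambda>x y. adj F x y \<and> x \<noteq> w \<and> y \<noteq> w) xs"
    using rtranclp_distinct_path[OF conn] by blast
  obtain ys where ys: "xs = z # ys" using xs by (cases xs) auto
  have "ys \<noteq> []" using xs ys ne by auto
  have step: "adj F (xs ! i) (xs ! Suc i) \<and> xs ! i \<noteq> w \<and> xs ! Suc i \<noteq> w"
    if "Suc i < length xs" for i
    using xs(5) that by (simp add: successively_conv_nth)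
  \<comment> \<open>Every vertex but the last is the source of a step; the last is the target of
    one, since the path has at least two vertices.\<close>
  have avoid: "x \<noteq> w \<and> x \<in> verts F" if x: "x \<in> set xs" for x
  proof -
    obtain i where i: "i < length xs" "x = xs ! i" using x by (metis in_set_conv_nth)
    show ?thesis
    proof (cases "Suc i < length xs")
      case True
      then show ?thesis using step[of i] adj_verts(1)[OF G] i by blast
    next
      case False
      then have "Suc (i - 1) = i" using i ys \<open>ys \<noteq> []\<close> by (cases i) auto
      then show ?thesis using step[of "i - 1"] adj_verts(2)[OF G] i by simp blast
    qed
  qed
  have "is_cycle F (w # xs)"
    unfolding is_cycle_def
  proof (intro conjI allI impI)
    show "3 \<le> length (w # xs)" using ys \<open>ys \<noteq> []\<close> by (cases ys) auto
    show "distinct (w # xs)" using xs avoid by auto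
    show "set (w # xs) \<subseteq> verts F" using avoid adj_verts[OF G z] by auto
    show "adj F (last (w # xs)) (hd (w # xs))" using xs z' by (simp add: adj_sym)
    fix i assume "i + 1 < length (w # xs)"
    then show "adj F ((w # xs) ! i) ((w # xs) ! (i + 1))"
      using step[of "i - 1"] ys z by (cases i) auto
  qed
  then show False using F by (auto simp: forest_def)
qed

section \<open>The invariant\<close>

text \<open>The degree is taken in all of \<open>F\<close>, so the notion stays fixed during the
  game. A low vertex has at most two neighbours and never runs out of three colours.\<close>

definition high :: "'a graph \<Rightarrow> 'a \<Rightarrow> bool" where
  "high F v \<longleftrightarrow> deg F v > 2"

lemma high_in_verts:
  assumes G: "graph F" and "high F u"
  shows "u \<in> verts F"
proof (rule ccontr)
  assume "u \<notin> verts F"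
  then have "{e \<in> edges F. u \<in> e} = {}" using graph_edge_subset[OF G] by blast
  then have "deg F u = 0" unfolding deg_def by (metis card.empty)
  with assms(2) show False by (simp add: high_def)
qed

definition link :: "'a graph \<Rightarrow> 'a coloring \<Rightarrow> 'a \<Rightarrow> 'a \<Rightarrow> bool" where
  "link F c x y \<longleftrightarrow> adj F x y \<and> c x = None \<and> c y = None \<and> (high F x \<or> high F y)"

definition comp :: "'a graph \<Rightarrow> 'a coloring \<Rightarrow> 'a \<Rightarrow> 'a set" where
  "comp F c x = {y. (link F c)\<^sup>*\<^sup>* x y}"

definition touch :: "'a graph \<Rightarrow> 'a coloring \<Rightarrow> 'a \<Rightarrow> nat \<Rightarrow> bool" where
  "touch F c x k \<longleftrightarrow> high F x \<and> c x = None \<and> (\<exists>w. adj F w x \<and> c w = Some k)"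

definition high_edge :: "'a graph \<Rightarrow> 'a coloring \<Rightarrow> 'a \<Rightarrow> 'a \<Rightarrow> bool" where
  "high_edge F c x y \<longleftrightarrow> adj F x y \<and> high F x \<and> high F y \<and> c x = None \<and> c y = None"

text \<open>The witnesses \<open>v\<close> and \<open>a\<close> need not be realised: if there are
  no touches and no high edges, any choice works, and \<open>v\<close> may be coloured, low or
  outside \<open>K\<close>.\<close>

definition good :: "'a graph \<Rightarrow> 'a coloring \<Rightarrow> 'a set \<Rightarrow> bool" where
  "good F c K \<longleftrightarrow> (\<exists>v a.
     (\<forall>x\<in>K. \<forall>k. touch F c x k \<longrightarrow> x = v \<and> k = a) \<and>
     (\<forall>x\<in>K. \<forall>y\<in>K. high_edge F c x y \<longrightarrow> x = v \<or> y = v) \<and>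
     ((\<forall>x\<in>K. \<forall>k. \<not> touch F c x k) \<or> (\<forall>x\<in>K. \<forall>y\<in>K. \<not> high_edge F c x y)))"

text \<open>The variable \<open>x\<close> ranges over the whole type: a coloured vertex has no
  links, and its singleton component is trivially good.\<close>

definition safe :: "'a graph \<Rightarrow> 'a coloring \<Rightarrow> bool" where
  "safe F c \<longleftrightarrow> (\<forall>x. good F c (comp F c x))"

lemma goodI:
  assumes "\<And>x k. x \<in> K \<Longrightarrow> touch F c x k \<Longrightarrow> x = v \<and> k = a"
    and "\<And>x y. x \<in> K \<Longrightarrow> y \<in> K \<Longrightarrow> \<not> high_edge F c x y"
  shows "good F c K"
  using assms unfolding good_def by blast

lemma goodI2:
  assumes "\<And>x k. x \<in> K \<Longrightarrow> \<not> touch F c x k"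
    and "\<And>x y. x \<in> K \<Longrightarrow> y \<in> K \<Longrightarrow> high_edge F c x y \<Longrightarrow> x = v \<or> y = v"
  shows "good F c K"
  using assms unfolding good_def by blast

lemma goodE:
  assumes "good F c K"
  obtains v a where "\<And>x k. x \<in> K \<Longrightarrow> touch F c x k \<Longrightarrow> x = v \<and> k = a"
    and "\<And>x y. x \<in> K \<Longrightarrow> y \<in> K \<Longrightarrow> high_edge F c x y \<Longrightarrow> x = v \<or> y = v"
    and "(\<forall>x\<in>K. \<forall>k. \<not> touch F c x k) \<or> (\<forall>x\<in>K. \<forall>y\<in>K. \<not> high_edge F c x y)"
proof -
  from assms obtain v a where "\<forall>x\<in>K. \<forall>k. touch F c x k \<longrightarrow> x = v \<and> k = a"
    and "\<forall>x\<in>K. \<forall>y\<in>K. high_edge F c x y \<longrightarrow> x = v \<or> y = v"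
    and "(\<forall>x\<in>K. \<forall>k. \<not> touch F c x k) \<or> (\<forall>x\<in>K. \<forall>y\<in>K. \<not> high_edge F c x y)"
    unfolding good_def by (elim exE conjE)
  then show ?thesis by (intro that[of v a]) simp_all
qed

lemma good_mono:
  assumes "good F c K" "K' \<subseteq> K"
    and "\<And>x k. x \<in> K' \<Longrightarrow> touch F c' x k \<Longrightarrow> touch F c x k"
    and "\<And>x y. high_edge F c' x y \<Longrightarrow> high_edge F c x y"
  shows "good F c' K'"
proof -
  obtain v a where t: "\<And>x k. x \<in> K \<Longrightarrow> touch F c x k \<Longrightarrow> x = v \<and> k = a"
    and e: "\<And>x y. x \<in> K \<Longrightarrow> y \<in> K \<Longrightarrow> high_edge F c x y \<Longrightarrow> x = v \<or> y = v"
    and te: "(\<forall>x\<in>K. \<forall>k. \<not> touch F c x k) \<or> (\<forall>x\<in>K. \<forall>y\<in>K. \<not> high_edge F c x y)"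
    by (rule goodE[OF assms(1)]) (rule that, blast+)
  from te show ?thesis
  proof
    assume "\<forall>x\<in>K. \<forall>k. \<not> touch F c x k"
    then show ?thesis using assms(2-4) e by (intro goodI2[where v = v]) blast+
  next
    assume "\<forall>x\<in>K. \<forall>y\<in>K. \<not> high_edge F c x y"
    then show ?thesis using assms(2-4) t by (intro goodI[where v = v and a = a]) blast+
  qed
qed

section \<open>Components of the link relation\<close>

lemma link_sym: "link F c x y \<Longrightarrow> link F c y x"
  by (auto simp: link_def adj_sym)

lemma comp_refl: "x \<in> comp F c x"
  by (simp add: comp_def)

lemma comp_sym: "y \<in> comp F c x \<Longrightarrow> x \<in> comp F c y"
  unfolding comp_def using symp_rtranclp[of "link F c"] link_sym
  by (metis mem_Collect_eq sympD sympI)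

lemma comp_trans: "y \<in> comp F c x \<Longrightarrow> z \<in> comp F c y \<Longrightarrow> z \<in> comp F c x"
  unfolding comp_def by simp

lemma comp_eq: "y \<in> comp F c x \<Longrightarrow> comp F c y = comp F c x"
  by (meson comp_sym comp_trans subsetI subset_antisym)

lemma comp_uncolored:
  assumes "y \<in> comp F c x"
  shows "y = x \<or> c x = None \<and> c y = None"
proof -
  have "(link F c)\<^sup>*\<^sup>* x y" using assms by (simp add: comp_def)
  then show ?thesis by (induction rule: rtranclp_induct) (auto simp: link_def)
qed

lemma comp_colored: "c x \<noteq> None \<Longrightarrow> comp F c x = {x}"
  using comp_uncolored[of _ F c x] comp_refl[of x F c] by fastforce

lemma good_colored: "c x \<noteq> None \<Longrightarrow> good F c (comp F c x)"
  by (rule goodI) (auto simp: comp_colored touch_def high_edge_def)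

lemma high_adj_comp:
  "adj F x y \<Longrightarrow> high F y \<Longrightarrow> c x = None \<Longrightarrow> c y = None \<Longrightarrow> y \<in> comp F c x"
  by (auto simp: comp_def link_def)

section \<open>The effect of colouring one vertex\<close>

lemma high_edge_update: "high_edge F (c(w := Some k)) x y \<longleftrightarrow> high_edge F c x y \<and> x \<noteq> w \<and> y \<noteq> w"
  by (auto simp: high_edge_def)

lemma touch_update:
  "c w = None \<Longrightarrow> touch F (c(w := Some k)) x j \<Longrightarrow> touch F c x j \<or> j = k \<and> adj F w x \<and> high F x \<and> c x = None"
  by (auto simp: touch_def split: if_splits)

lemma comp_update_subset:
  "comp F (c(w := Some k)) x \<subseteq> comp F c x"
proof -
  have "link F (c(w := Some k)) u v \<Longrightarrow> link F c u v" for u v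
    by (auto simp: link_def split: if_splits)
  then show ?thesis unfolding comp_def by (auto elim: rtranclp_mono[THEN predicate2D, rotated])
qed

lemma comp_update_avoid: "x \<noteq> w \<Longrightarrow> w \<notin> comp F (c(w := Some k)) x"
  using comp_uncolored[of w F "c(w := Some k)" x] by auto

text \<open>Links in the new position avoid the coloured vertex \<open>w\<close>, so two neighbours
  of \<open>w\<close> in one component would be joined around \<open>w\<close>. Hence one move
  touches each component at most once.\<close>

lemma comp_update_neighbour_unique:
  assumes F: "forest F" and y: "y \<in> comp F (c(w := Some k)) x" and y': "y' \<in> comp F (c(w := Some k)) x"
    and "adj F w y" "adj F w y'"
  shows "y = y'"
proof (rule forest_neighbours_separated[OF F assms(4,5)])
  have "y' \<in> comp F (c(w := Some k)) y" using y y' comp_sym comp_trans by metis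
  then have "(link F (c(w := Some k)))\<^sup>*\<^sup>* y y'" by (simp add: comp_def)
  then show "(\<lambda>x y. adj F x y \<and> x \<noteq> w \<and> y \<noteq> w)\<^sup>*\<^sup>* y y'"
    by (rule rtranclp_mono[THEN predicate2D, rotated]) (auto simp: link_def)
qed

text \<open>A new touch sits at an uncoloured high neighbour of \<open>w\<close>. That vertex was
  linked to \<open>w\<close>, so it lies in the old component of \<open>w\<close>.\<close>

lemma good_update_outside:
  assumes "c w = None" "x \<notin> comp F c w" "good F c (comp F c x)"
  shows "good F (c(w := Some k)) (comp F (c(w := Some k)) x)"
proof -
  let ?c = "c(w := Some k)" and ?K = "comp F (c(w := Some k)) x"
  have sub: "y \<in> ?K \<Longrightarrow> y \<in> comp F c x" for y using comp_update_subset by fast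
  have t: "touch F c y j" if "y \<in> ?K" "touch F ?c y j" for y j
  proof (rule ccontr)
    assume "\<not> touch F c y j"
    with touch_update[where c = c, OF assms(1) that(2)] have "y \<in> comp F c w"
      using high_adj_comp[of F w y c] assms(1) by blast
    moreover have "x \<in> comp F c y" using sub[OF that(1)] by (rule comp_sym)
    ultimately show False using assms(2) comp_trans by metis
  qed
  have e: "high_edge F c y z" if "high_edge F ?c y z" for y z
    using that by (simp add: high_edge_update)
  show ?thesis by (rule good_mono[OF assms(3) comp_update_subset t e])
qed

text \<open>Colouring \<open>w\<close> acts only on its old component, and each piece left there
  contains at most one neighbour of \<open>w\<close>. Assuming goodness only outside this component
  lets the lemma serve when the component itself is bad.\<close>

lemma safe_update:
  assumes F: "forest F" and w: "c w = None"
    and out: "\<And>x. x \<notin> comp F c w \<Longrightarrow> good F c (comp F c x)"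
    and inn: "\<And>K. K \<subseteq> comp F c w \<Longrightarrow> w \<notin> K \<Longrightarrow>
      (\<And>y y'. y \<in> K \<Longrightarrow> y' \<in> K \<Longrightarrow> adj F w y \<Longrightarrow> adj F w y' \<Longrightarrow> y = y') \<Longrightarrow>
      good F (c(w := Some k)) K"
  shows "safe F (c(w := Some k))"
  unfolding safe_def
proof
  fix x
  consider "x = w" | "x \<notin> comp F c w" | "x \<noteq> w" "x \<in> comp F c w" by blast
  then show "good F (c(w := Some k)) (comp F (c(w := Some k)) x)"
  proof cases
    case 1
    then show ?thesis by (simp add: good_colored)
  next
    case 2
    then show ?thesis using good_update_outside[where c = c, OF w 2 out] by blast
  next
    case 3
    show ?thesis
    proof (rule inn)
      show "comp F (c(w := Some k)) x \<subseteq> comp F c w"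
        using comp_update_subset[of F c w k x] comp_eq[OF 3(2)] by simp
      show "w \<notin> comp F (c(w := Some k)) x" using 3(1) by (rule comp_update_avoid)
    qed (rule comp_update_neighbour_unique[OF F])
  qed
qed

section \<open>Playing the game\<close>

text \<open>Neighbours showing three different colours would give three different edges at
  \<open>v\<close>.\<close>

lemma free_color_low:
  fixes c :: "'a coloring"
  assumes G: "graph F" and "\<not> high F v"
  shows "\<exists>k<3. \<forall>u. adj F u v \<longrightarrow> c u \<noteq> Some k"
proof (rule ccontr)
  assume "\<not> ?thesis"
  then have "\<forall>k\<in>{..<3::nat}. \<exists>u. adj F u v \<and> c u = Some k" by auto
  then obtain f where f: "\<And>k. k < (3::nat) \<Longrightarrow> adj F (f k) v \<and> c (f k) = Some k"
    by (metis lessThan_iff)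
  have "card {..<3::nat} \<le> card {e \<in> edges F. v \<in> e}"
  proof (rule card_inj_on_le)
    show "inj_on (\<lambda>k. {f k, v}) {..<3}"
    proof (rule inj_onI)
      fix i j :: nat assume "i \<in> {..<3}" "j \<in> {..<3}" and eq: "{f i, v} = {f j, v}"
      then have i: "adj F (f i) v" "c (f i) = Some i" and j: "adj F (f j) v" "c (f j) = Some j"
        using f by auto
      have "f i = f j" using eq i(1) j(1) by (auto simp: doubleton_eq_iff adj_def)
      with i(2) j(2) show "i = j" by (metis option.inject)
    qed
    show "(\<lambda>k. {f k, v}) ` {..<3} \<subseteq> {e \<in> edges F. v \<in> e}"
      using f by (auto simp: adj_def)
    show "finite {e \<in> edges F. v \<in> e}" using graph_finite_edges[OF G] by simp
  qed
  then show False using assms(2) by (simp add: high_def deg_def)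
qed

text \<open>At an uncoloured high vertex the touches are exactly the forbidden colours, and two of
  them leave one of three free.\<close>

lemma legal_two_colors:
  assumes v: "v \<in> verts F" and c: "c v = None" and h: "high F v"
    and t: "\<And>k. touch F c v k \<Longrightarrow> k = a \<or> k = a'"
  shows "\<exists>k. legal_move F 3 c v k"
proof -
  obtain k :: nat where k: "k < 3" "k \<noteq> a" "k \<noteq> a'"
  proof -
    have "\<not> {..<3::nat} \<subseteq> {a, a'}"
    proof
      assume "{..<3::nat} \<subseteq> {a, a'}"
      then have "card {..<3::nat} \<le> card {a, a'}" by (intro card_mono) auto
      then show False by (cases "a = a'") auto
    qed
    then show ?thesis using that by auto
  qed
  have "legal_move F 3 c v k"
    unfolding legal_move_def using v c h k t[of k] by (auto simp: touch_def)
  then show ?thesis ..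
qed

lemma not_blockedI:
  assumes G: "graph F"
    and t: "\<And>v. \<exists>a a'. \<forall>k. touch F c v k \<longrightarrow> k = a \<or> k = a'"
  shows "\<not> blocked F 3 c"
proof
  assume "blocked F 3 c"
  then obtain v where v: "v \<in> verts F" "c v = None" "\<forall>k<3. \<exists>u. adj F u v \<and> c u = Some k"
    unfolding blocked_def by blast
  show False
  proof (cases "high F v")
    case True
    obtain a a' where "\<forall>k. touch F c v k \<longrightarrow> k = a \<or> k = a'" using t by blast
    then obtain k where "legal_move F 3 c v k" using legal_two_colors[where c = c, OF v(1,2) True] by metis
    then show False using v unfolding legal_move_def by blast
  next
    case False
    then show False using free_color_low[OF G False, of c] v(3) by blast
  qed
qed

lemma safe_one_color:
  assumes "safe F c"
  shows "\<exists>a. \<forall>k. touch F c v k \<longrightarrow> k = a"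
proof -
  have "good F c (comp F c v)" using assms by (simp add: safe_def)
  then show ?thesis using comp_refl[of v F c] by (elim goodE) blast
qed

lemma safe_not_blocked:
  assumes "graph F" "safe F c"
  shows "\<not> blocked F 3 c"
  using safe_one_color[OF assms(2)] by (intro not_blockedI[OF assms(1)]) meson

text \<open>An uncoloured high vertex sees at most one colour in a safe position, and Bob's move
  adds at most the colour \<open>k\<close>.\<close>

lemma safe_not_blocked_update:
  assumes "graph F" "safe F c" "c q = None"
  shows "\<not> blocked F 3 (c(q := Some k))"
proof (rule not_blockedI[OF assms(1)])
  fix v
  obtain a where "\<forall>j. touch F c v j \<longrightarrow> j = a" using safe_one_color[OF assms(2)] by blast
  then show "\<exists>a a'. \<forall>j. touch F (c(q := Some k)) v j \<longrightarrow> j = a \<or> j = a'"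
    using touch_update[where c = c, OF assms(3)] by blast
qed

text \<open>All high edges of the component disappear with \<open>w\<close>, and so do its old
  touches. Each remaining piece can be touched only at its single neighbour of \<open>w\<close>,
  with colour \<open>k\<close>.\<close>

lemma safe_update_center:
  assumes F: "forest F" and w: "c w = None" "high F w"
    and out: "\<And>x. x \<notin> comp F c w \<Longrightarrow> good F c (comp F c x)"
    and t: "\<And>x j. x \<in> comp F c w \<Longrightarrow> touch F c x j \<Longrightarrow> x = w"
    and e: "\<And>x y. x \<in> comp F c w \<Longrightarrow> y \<in> comp F c w \<Longrightarrow> high_edge F c x y \<Longrightarrow> x = w \<or> y = w"
  shows "safe F (c(w := Some k))"
proof (rule safe_update[where c = c and w = w, OF F w(1) out])
  fix K assume K: "K \<subseteq> comp F c w" "w \<notin> K"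
    and uniq: "\<And>y y'. y \<in> K \<Longrightarrow> y' \<in> K \<Longrightarrow> adj F w y \<Longrightarrow> adj F w y' \<Longrightarrow> y = y'"
  show "good F (c(w := Some k)) K"
  proof (rule goodI)
    fix x j assume x: "x \<in> K" "touch F (c(w := Some k)) x j"
    then have "j = k \<and> adj F w x" using touch_update[where c = c and w = w, OF w(1) x(2)] t[of x j] K by blast
    \<comment> \<open>The centre of a piece is its only neighbour of \<open>w\<close>. If there is
      none, the piece has no touch and the unspecified value does no harm.\<close>
    then show "x = (THE y. y \<in> K \<and> adj F w y) \<and> j = k"
      using uniq x(1) by (metis (mono_tags, lifting) the_equality)
  next
    fix x y assume "x \<in> K" "y \<in> K"
    then show "\<not> high_edge F (c(w := Some k)) x y"
      using e[of x y] K by (auto simp: high_edge_update)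
  qed
qed

text \<open>Alice may pass: colouring the centre of a component keeps the position safe.\<close>

lemma safe_tempo:
  assumes F: "forest F" and s: "safe F c" and nc: "\<not> all_colored F c"
  shows "\<exists>w j. legal_move F 3 c w j \<and> safe F (c(w := Some j))"
proof -
  have G: "graph F" using F by (simp add: forest_def)
  show ?thesis
  proof (cases "\<exists>x\<in>verts F. c x = None \<and> high F x")
    case True
    then obtain x where x: "x \<in> verts F" "c x = None" "high F x" by blast
    define K where "K = comp F c x"
    have gK: "good F c K" using s by (simp add: safe_def K_def)
    obtain v a where t: "\<And>y k. y \<in> K \<Longrightarrow> touch F c y k \<Longrightarrow> y = v \<and> k = a"
      and e: "\<And>y z. y \<in> K \<Longrightarrow> z \<in> K \<Longrightarrow> high_edge F c y z \<Longrightarrow> y = v \<or> z = v"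
      by (rule goodE[OF gK]) (rule that, blast+)
    \<comment> \<open>The centre \<open>v\<close> may be unusable for a move. In that case
      \<open>K\<close> has neither touches nor high edges, and the high vertex \<open>x\<close> can
      replace it.\<close>
    obtain w where w: "w \<in> K" "w \<in> verts F" "c w = None" "high F w"
      and t': "\<And>y k. y \<in> K \<Longrightarrow> touch F c y k \<Longrightarrow> y = w \<and> k = a"
      and e': "\<And>y z. y \<in> K \<Longrightarrow> z \<in> K \<Longrightarrow> high_edge F c y z \<Longrightarrow> y = w \<or> z = w"
    proof (cases "v \<in> K \<and> v \<in> verts F \<and> c v = None \<and> high F v")
      case True
      then show ?thesis using that[of v] t e by blast
    next
      case False
      have "\<not> touch F c y k" if "y \<in> K" for y k
        using t[OF that] False that adj_verts[OF G] unfolding touch_def by blast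
      moreover have "\<not> high_edge F c y z" if "y \<in> K" "z \<in> K" for y z
        using e[OF that] False that adj_verts[OF G] unfolding high_edge_def by blast
      ultimately show ?thesis using that[of x] x comp_refl[of x F c] K_def by blast
    qed
    have Kw: "K = comp F c w" using comp_eq[of w F c x] w(1) K_def by simp
    obtain j where j: "legal_move F 3 c w j"
      using legal_two_colors[where c = c, OF w(2,3,4), of a a] t'[OF w(1)] by blast
    have "safe F (c(w := Some j))"
    proof (rule safe_update_center[where c = c and w = w, OF F w(3,4)], fold Kw)
      show "good F c (comp F c y)" for y using s by (simp add: safe_def)
    qed (use t' e' in blast)+
    with j show ?thesis by blast
  next
    case False
    obtain x where x: "x \<in> verts F" "c x = None" using nc by (auto simp: all_colored_def)
    then obtain j where j: "j < 3" "\<forall>u. adj F u x \<longrightarrow> c u \<noteq> Some j"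
      using free_color_low[OF G, of x c] False by blast
    \<comment> \<open>No uncoloured high vertex is left, so touches and high edges are impossible
      and every further move is safe.\<close>
    have "c u \<noteq> None" if "high F u" for u
      using False that high_in_verts[OF G that] by auto
    then have no: "\<not> (high F u \<and> (c(x := Some j)) u = None)" for u by simp
    have "\<not> touch F (c(x := Some j)) u i" "\<not> high_edge F (c(x := Some j)) u u'" for u u' i
      unfolding touch_def high_edge_def using no[of u] by blast+
    then have "safe F (c(x := Some j))" by (simp add: safe_def good_def)
    with j x show ?thesis unfolding legal_move_def by blast
  qed
qed

text \<open>After Bob colours \<open>q\<close> with \<open>k\<close>, the only component that may fail to be good is the one of
  the old centre \<open>v\<close>; there \<open>z\<close> is the neighbour of \<open>q\<close>.\<close>

definition repairable :: "'a graph \<Rightarrow> 'a coloring \<Rightarrow> 'a \<Rightarrow> 'a \<Rightarrow> 'a \<Rightarrow> nat \<Rightarrow> bool" where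
  "repairable F c q v z k \<longleftrightarrow> c v = None \<and> c z = None \<and> high F v \<and> high F z \<and> adj F q z \<and> c q = Some k \<and>
     z \<in> comp F c v \<and> (\<forall>x. x \<notin> comp F c v \<longrightarrow> good F c (comp F c x)) \<and>
     ((\<exists>a. (\<forall>x\<in>comp F c v. \<forall>j. touch F c x j \<longrightarrow> x = v \<and> j = a \<or> x = z \<and> j = k) \<and>
           (\<forall>x\<in>comp F c v. \<forall>y\<in>comp F c v. \<not> high_edge F c x y)) \<or>
      (\<forall>x\<in>comp F c v. \<forall>j. touch F c x j \<longrightarrow> x = z \<and> j = k) \<and>
      (\<forall>x\<in>comp F c v. \<forall>y\<in>comp F c v. high_edge F c x y \<longrightarrow> x = v \<or> y = v))"

text \<open>Every piece that stops being good must contain the old centre \<open>v\<close>, so there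
  is only one such piece.\<close>

lemma safe_bob_move:
  assumes F: "forest F" and s: "safe F c" and q: "c q = None"
  shows "safe F (c(q := Some k)) \<or> (\<exists>v z. repairable F (c(q := Some k)) q v z k)"
proof -
  let ?c = "c(q := Some k)"
  have "\<exists>v z. repairable F ?c q v z k" if ns: "\<not> safe F ?c"
  proof -
    from ns obtain x0 where x0: "\<not> good F ?c (comp F ?c x0)" by (auto simp: safe_def)
    define K where "K = comp F c q"
    have gK: "good F c K" using s by (simp add: safe_def K_def)
    obtain v a where t: "\<And>y k. y \<in> K \<Longrightarrow> touch F c y k \<Longrightarrow> y = v \<and> k = a"
      and e: "\<And>y z. y \<in> K \<Longrightarrow> z \<in> K \<Longrightarrow> high_edge F c y z \<Longrightarrow> y = v \<or> z = v"
      and te: "(\<forall>y\<in>K. \<forall>k. \<not> touch F c y k) \<or> (\<forall>y\<in>K. \<forall>z\<in>K. \<not> high_edge F c y z)"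
      by (rule goodE[OF gK]) (rule that, blast+)
    have bad: "v \<in> comp F ?c x \<and> high F v \<and> ?c v = None \<and>
        (\<exists>z\<in>comp F ?c x. high F z \<and> adj F q z \<and> ?c z = None \<and>
          (\<forall>y\<in>comp F ?c x. \<forall>j. touch F ?c y j \<longrightarrow> touch F c y j \<or> y = z \<and> j = k)) \<and>
        comp F ?c x \<subseteq> K"
      if b: "\<not> good F ?c (comp F ?c x)" for x
    proof -
      let ?L = "comp F ?c x"
      have xq: "x \<noteq> q" using b good_colored[of ?c q F] by auto
      have xK: "x \<in> K"
        using b good_update_outside[where c = c and w = q, OF q] s unfolding K_def safe_def by blast
      have L: "?L \<subseteq> K" using comp_update_subset[of F c q k x] comp_eq xK unfolding K_def by fast
      have qL: "q \<notin> ?L" using comp_update_avoid[where c = c, OF xq] .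
      have e': "high_edge F c y z" if "high_edge F ?c y z" for y z
        using that by (simp add: high_edge_update)
      \<comment> \<open>Without a new touch the piece would inherit goodness from
        \<open>K\<close>.\<close>
      have "\<exists>z\<in>?L. high F z \<and> adj F q z \<and> c z = None"
      proof (rule ccontr)
        assume no: "\<not> ?thesis"
        have "good F ?c ?L"
        proof (rule good_mono[OF gK L _ e'])
          fix y j assume y: "y \<in> ?L" "touch F ?c y j"
          from touch_update[where c = c and w = q, OF q y(2)] show "touch F c y j"
            using no y(1) by blast
        qed
        with b show False ..
      qed
      then obtain z where z: "z \<in> ?L" "high F z" "adj F q z" "c z = None" by blast
      have t': "touch F c y j \<or> y = z \<and> j = k" if "y \<in> ?L" "touch F ?c y j" for y j
        using touch_update[where c = c and w = q, OF q that(2)]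
          comp_update_neighbour_unique[OF F that(1) z(1) _ z(3)] by blast
      \<comment> \<open>A remaining high edge has \<open>v\<close> as an end. If there is none, the
        piece is bad only because some touch differs from the new one at \<open>z\<close>; that
        touch is old and hence at \<open>v\<close>.\<close>
      have "v \<in> ?L \<and> high F v \<and> c v = None"
      proof (cases "\<exists>y\<in>?L. \<exists>y'\<in>?L. high_edge F ?c y y'")
        case True
        then obtain y y' where y: "y \<in> ?L" "y' \<in> ?L" "high_edge F c y y'" using e' by blast
        then have "v = y \<or> v = y'" using e L by blast
        with y show ?thesis unfolding high_edge_def by blast
      next
        case False
        then obtain y j where "y \<in> ?L" "touch F c y j"
          using goodI[where K = ?L and F = F and c = ?c and v = z and a = k] t' b by blast
        then show ?thesis using t L unfolding touch_def by blast
      qed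
      then show ?thesis using z t' L qL by (metis fun_upd_other)
    qed
    from bad[OF x0] obtain z where v: "v \<in> comp F ?c x0" "high F v" "?c v = None"
      and z: "z \<in> comp F ?c x0" "high F z" "adj F q z" "?c z = None"
      and t': "\<And>y j. y \<in> comp F ?c x0 \<Longrightarrow> touch F ?c y j \<Longrightarrow> touch F c y j \<or> y = z \<and> j = k"
      and L: "comp F ?c x0 \<subseteq> K" by blast
    have eq: "comp F ?c x0 = comp F ?c v" using comp_eq[OF v(1)] by simp
    \<comment> \<open>Another bad component would also contain \<open>v\<close> and thus coincide
      with this one.\<close>
    have out: "good F ?c (comp F ?c x)" if "x \<notin> comp F ?c v" for x
      using that bad[of x] comp_sym by metis
    have e': "high_edge F c y y'" if "high_edge F ?c y y'" for y y'
      using that by (simp add: high_edge_update)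
    have "repairable F ?c q v z k"
      unfolding repairable_def
      \<comment> \<open>If \<open>K\<close> had no touches, the second alternative of
        \<open>repairable\<close> holds; if it had no high edges, the first does.\<close>
      using te
    proof (elim disjE, goal_cases)
      case 1
      then have "(\<forall>x\<in>comp F ?c v. \<forall>j. touch F ?c x j \<longrightarrow> x = z \<and> j = k) \<and>
        (\<forall>x\<in>comp F ?c v. \<forall>y\<in>comp F ?c v. high_edge F ?c x y \<longrightarrow> x = v \<or> y = v)"
        using t' e e' L unfolding eq by blast
      then show ?case using v z out unfolding eq by simp
    next
      case 2
      then have A: "(\<forall>x\<in>comp F ?c v. \<forall>j. touch F ?c x j \<longrightarrow> x = v \<and> j = a \<or> x = z \<and> j = k) \<and>
             (\<forall>x\<in>comp F ?c v. \<forall>y\<in>comp F ?c v. \<not> high_edge F ?c x y)"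
        using t' t e' L unfolding eq by blast
      show ?case by (intro conjI disjI1 exI[of _ a]; use v z out A eq in simp)
    qed
    then show ?thesis by blast
  qed
  then show ?thesis by blast
qed

text \<open>Alice colours \<open>v\<close> or \<open>z\<close>. In case \<open>A\<close> the
  component has no high edges; in case \<open>B\<close> all its touches are at \<open>z\<close> with
  colour \<open>k\<close>, but it may have high edges at \<open>v\<close>.\<close>

lemma repair:
  assumes F: "forest F" and r: "repairable F c q v z k" and k: "k < 3"
  shows "\<exists>w j. legal_move F 3 c w j \<and> safe F (c(w := Some j))"
proof -
  have G: "graph F" using F by (simp add: forest_def)
  let ?K = "comp F c v"
  have v: "c v = None" "high F v" and z: "c z = None" "high F z" "adj F q z" "z \<in> ?K" "c q = Some k"
    and out: "\<And>x. x \<notin> ?K \<Longrightarrow> good F c (comp F c x)"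
    using r by (auto simp: repairable_def)
  note inV = high_in_verts[OF G]
  have vK: "v \<in> ?K" by (rule comp_refl)
  have Kz: "comp F c z = ?K" using comp_eq[OF z(4)] .
  consider (A) a where "\<And>x j. x \<in> ?K \<Longrightarrow> touch F c x j \<Longrightarrow> x = v \<and> j = a \<or> x = z \<and> j = k"
      and "\<And>x y. x \<in> ?K \<Longrightarrow> y \<in> ?K \<Longrightarrow> \<not> high_edge F c x y"
    | (B) "\<And>x j. x \<in> ?K \<Longrightarrow> touch F c x j \<Longrightarrow> x = z \<and> j = k"
      and "\<And>x y. x \<in> ?K \<Longrightarrow> y \<in> ?K \<Longrightarrow> high_edge F c x y \<Longrightarrow> x = v \<or> y = v"
    using r unfolding repairable_def by blast
  then show ?thesis
  proof cases
    case A
    obtain j where j: "legal_move F 3 c v j"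
      using legal_two_colors[where c = c, OF inV[OF v(2)] v, of a k] A(1)[OF vK] by blast
    have "safe F (c(v := Some j))"
    proof (rule safe_update[where c = c and w = v, OF F v(1) out])
      fix K assume K: "K \<subseteq> ?K" "v \<notin> K"
      show "good F (c(v := Some j)) K"
      proof (rule goodI)
        fix x i assume x: "x \<in> K" "touch F (c(v := Some j)) x i"
        \<comment> \<open>A new touch at \<open>x\<close> would make \<open>v\<close> and
          \<open>x\<close> a high edge, which case \<open>A\<close> excludes. So only touches at
          \<open>z\<close> survive.\<close>
        have "touch F c x i"
          using touch_update[where c = c and w = v, OF v(1) x(2)] A(2)[OF vK, of x] x(1) K v
          unfolding high_edge_def by blast
        then show "x = z \<and> i = k" using A(1) x(1) K by blast
      qed (use A(2) K in \<open>auto simp: high_edge_update\<close>)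
    qed
    with j show ?thesis by blast
  next
    case B
    consider "z = v" | "z \<noteq> v" "\<not> adj F z v" | "z \<noteq> v" "adj F z v" by blast
    then show ?thesis
    proof cases
      case 1
      obtain j where j: "legal_move F 3 c v j"
        using legal_two_colors[where c = c, OF inV[OF v(2)] v, of k k] B(1)[OF vK] by blast
      have "safe F (c(v := Some j))"
        by (rule safe_update_center[where c = c and w = v, OF F v out]) (use B 1 in blast)+
      with j show ?thesis by blast
    next
      case 2
      obtain j where j: "legal_move F 3 c z j"
        using legal_two_colors[where c = c, OF inV[OF z(2)] z(1,2), of k k] B(1)[OF z(4)] by blast
      have "safe F (c(z := Some j))"
      proof (rule safe_update[where c = c and w = z, OF F z(1)], unfold Kz)
        fix K assume K: "K \<subseteq> ?K" "z \<notin> K"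
        show "good F (c(z := Some j)) K"
        proof (rule goodI2)
          fix x i assume x: "x \<in> K"
          show "\<not> touch F (c(z := Some j)) x i"
          proof
            assume "touch F (c(z := Some j)) x i"
            \<comment> \<open>A vertex newly touched from \<open>z\<close> forms a high edge with
              \<open>z\<close>, so it must be \<open>v\<close>, which is not adjacent to
              \<open>z\<close>. The pieces have no touches and keep the centre
              \<open>v\<close>.\<close>
            from touch_update[where c = c and w = z, OF z(1) this] have "high_edge F c z x"
              using B(1)[of x i] x K z unfolding high_edge_def by blast
            then have "x = v" using B(2)[OF z(4), of x] x K 2 by blast
            then show False using 2 \<open>high_edge F c z x\<close> by (simp add: high_edge_def)
          qed
        next
          fix x y assume "x \<in> K" "y \<in> K" "high_edge F (c(z := Some j)) x y"
          then show "x = v \<or> y = v" using B(2) K by (auto simp: high_edge_update)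
        qed
      qed (rule out)
      with j show ?thesis by blast
    next
      case 3
      \<comment> \<open>Since all touches are at \<open>z\<close>, the vertex \<open>v\<close> sees
        no colour yet and may repeat the colour of \<open>q\<close>.\<close>
      have j: "legal_move F 3 c v k"
        unfolding legal_move_def
      proof (intro conjI allI impI)
        fix u assume "adj F u v"
        then show "c u \<noteq> Some k" using B(1)[OF vK, of k] 3 v unfolding touch_def by blast
      qed (use inV v k in auto)
      have "safe F (c(v := Some k))"
      proof (rule safe_update[where c = c and w = v, OF F v(1) out])
        fix K assume K: "K \<subseteq> ?K" "v \<notin> K"
          and uniq: "\<And>y y'. y \<in> K \<Longrightarrow> y' \<in> K \<Longrightarrow> adj F v y \<Longrightarrow> adj F v y' \<Longrightarrow> y = y'"
        show "good F (c(v := Some k)) K"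
        proof (rule goodI)
          fix x i assume x: "x \<in> K" "touch F (c(v := Some k)) x i"
          \<comment> \<open>Old touches are at \<open>z\<close>, itself a neighbour of
            \<open>v\<close>, with the same colour \<open>k\<close>. They therefore agree with the
            touches made by \<open>v\<close>.\<close>
          have "i = k \<and> adj F v x"
            using touch_update[where c = c and w = v, OF v(1) x(2)] B(1)[of x i] x(1) K
              adj_sym[OF 3(2)] by blast
          then show "x = (THE y. y \<in> K \<and> adj F v y) \<and> i = k"
            using uniq x(1) by (metis (mono_tags, lifting) the_equality)
        next
          fix x y assume "x \<in> K" "y \<in> K"
          then show "\<not> high_edge F (c(v := Some k)) x y"
            using B(2)[of x y] K by (auto simp: high_edge_update)
        qed
      qed
      with j show ?thesis by blast
    qed
  qed
qed

text \<open>The induction runs over full rounds: Bob's move, then Alice's reply by a repair or a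
  tempo move, which makes the position safe again.\<close>

lemma safe_alice_wins:
  assumes F: "forest F" and "safe F c"
  shows "alice_wins_from F 3 c False"
  using assms(2)
proof (induction "card {v \<in> verts F. c v = None}" arbitrary: c rule: less_induct)
  case (less c)
  have G: "graph F" using F by (simp add: forest_def)
  have dec: "card {v \<in> verts F. (c(w := Some j)) v = None} < card {v \<in> verts F. c v = None}"
    if "w \<in> verts F" "c w = None" for w j and c :: "'a coloring"
    using G that by (intro psubset_card_mono) (auto simp: graph_def)
  show ?case
  proof (cases "all_colored F c")
    case True
    then show ?thesis by (rule finished)
  next
    case False
    show ?thesis
    proof (rule bob[OF False safe_not_blocked[OF G less.prems]], intro allI impI)
      fix q k assume lm: "legal_move F 3 c q k"
      then have q: "c q = None" "q \<in> verts F" "k < 3" by (auto simp: legal_move_def)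
      let ?c = "c(q := Some k)"
      show "alice_wins_from F 3 ?c True"
      proof (cases "all_colored F ?c")
        case True
        then show ?thesis by (rule finished)
      next
        case False
        obtain w j where w: "legal_move F 3 ?c w j" "safe F (?c(w := Some j))"
          using safe_bob_move[where c = c and q = q, OF F less.prems q(1), of k] safe_tempo[OF F _ False] repair[OF F _ q(3)]
          by blast
        have "w \<in> verts F" "?c w = None" using w(1) unfolding legal_move_def by blast+
        then have "alice_wins_from F 3 (?c(w := Some j)) False"
          using less.hyps[OF _ w(2)] dec[of w ?c j] dec[of q c k] q by simp
        then show ?thesis
          by (rule alice[OF False safe_not_blocked_update[OF G less.prems q(1)] w(1)])
      qed
    qed
  qed
qed

section \<open>Trunks\<close>

text \<open>A candidate containing \<open>x\<close> with the most vertices and edges is a trunk.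
  Candidates exist because the single vertex \<open>x\<close> is uncoloured, which makes the leaf
  condition vacuous.\<close>

lemma trunk_exists:
  assumes fin: "finite (verts G)" "finite (edges G)" and x: "x \<in> verts G" "x \<notin> C"
  shows "\<exists>R. trunk G C R \<and> x \<in> verts R"
proof -
  define A where "A = {R. trunk_cond G C R \<and> x \<in> verts R}"
  have "A \<subseteq> Pow (verts G) \<times> Pow (edges G)"
    unfolding A_def trunk_cond_def subgraph_def verts_def edges_def by auto
  then have finA: "finite A" by (rule finite_subset) (use fin in simp)
  have "({x}, {}) \<in> A"
    using x unfolding A_def trunk_cond_def subgraph_def connected_def verts_def edges_def by auto
  then obtain R where R: "R \<in> A" and max: "\<And>R'. R' \<in> A \<Longrightarrow>
      card (verts R') + card (edges R') \<le> card (verts R) + card (edges R)"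
  proof -
    let ?f = "\<lambda>R. card (verts R) + card (edges R)"
    have ne: "?f ` A \<noteq> {}" using \<open>({x}, {}) \<in> A\<close> by blast
    have fin: "finite (?f ` A)" using finA by (rule finite_imageI)
    obtain R where R: "R \<in> A" "Max (?f ` A) = ?f R" using Max_in[OF fin ne] by (rule imageE)
    have "?f R' \<le> ?f R" if "R' \<in> A" for R'
      using Max_ge[OF fin imageI[OF that]] R(2) by simp
    with R(1) show ?thesis by (rule that)
  qed
  have "trunk G C R"
    unfolding trunk_def
  proof (intro conjI notI)
    show "trunk_cond G C R" using R by (simp add: A_def)
    assume "\<exists>R'. R' \<noteq> R \<and> subgraph R R' \<and> trunk_cond G C R'"
    then obtain R' where R': "R' \<noteq> R" "subgraph R R'" "trunk_cond G C R'" by blast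
    then have sub: "verts R \<subseteq> verts R'" "edges R \<subseteq> edges R'" by (auto simp: subgraph_def)
    then have "R' \<in> A" using R R' by (auto simp: A_def)
    have fin': "finite (verts R')" "finite (edges R')"
      using R'(3) finite_subset[OF _ fin(1)] finite_subset[OF _ fin(2)]
      by (simp_all add: trunk_cond_def subgraph_def)
    have "card (verts R) = card (verts R')" "card (edges R) = card (edges R')"
      using max[OF \<open>R' \<in> A\<close>] card_mono[OF fin'(1) sub(1)] card_mono[OF fin'(2) sub(2)] by linarith+
    then have "verts R = verts R' \<and> edges R = edges R'"
      using card_subset_eq[OF fin'(1) sub(1)] card_subset_eq[OF fin'(2) sub(2)] by simp
    then show False using R'(1) by (simp add: verts_def edges_def prod_eq_iff)
  qed
  with R show ?thesis unfolding A_def by blast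
qed

text \<open>Adding \<open>z\<close> and the edge to it yields another candidate, so by maximality
  both are already present. A coloured \<open>z\<close> already in \<open>R\<close> is excluded
  because its degree could rise to 2.\<close>

lemma trunk_closed:
  assumes T: "trunk G C R" and y: "y \<in> verts R" "y \<notin> C" and yz: "adj G y z" "z \<in> verts G"
    and z: "z \<notin> C \<or> z \<notin> verts R"
  shows "z \<in> verts R \<and> {y, z} \<in> edges R"
proof -
  define R' where "R' = (insert z (verts R), insert {y, z} (edges R))"
  have [simp]: "verts R' = insert z (verts R)" "edges R' = insert {y, z} (edges R)"
    by (simp_all add: R'_def verts_def edges_def)
  have tc: "trunk_cond G C R" using T by (simp add: trunk_def)
  then have sub: "subgraph R G" and conn: "connected R" and leaf: "\<And>v. v \<in> verts R \<Longrightarrow> v \<in> C \<Longrightarrow> deg R v = 1"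
    by (auto simp: trunk_cond_def)
  have "subgraph R R'" using sub by (auto simp: subgraph_def)
  moreover have "trunk_cond G C R'"
    unfolding trunk_cond_def
  proof (intro conjI ballI)
    show "subgraph R' G" using sub y yz by (auto simp: subgraph_def adj_def)
    let ?r = "{(a, b). adj R' a b}"
    have old: "(a, b) \<in> ?r\<^sup>*" if "a \<in> verts R" "b \<in> verts R" for a b
    proof -
      have "(a, b) \<in> {(a, b). adj R a b}\<^sup>*" using conn that by (auto simp: connected_def)
      then show ?thesis by (rule rtrancl_mono[THEN subsetD, rotated]) (auto simp: adj_def)
    qed
    have yz': "(y, z) \<in> ?r" "(z, y) \<in> ?r" using yz by (auto simp: adj_def insert_commute)
    show "connected R'"
      unfolding connected_def
    proof (intro conjI ballI)
      fix a b assume a: "a \<in> verts R'" and b: "b \<in> verts R'"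
      have "(a, y) \<in> ?r\<^sup>*" using a old[of a y] y yz' by auto
      moreover have "(y, b) \<in> ?r\<^sup>*" using b old[of y b] y yz' by auto
      ultimately show "(a, b) \<in> ?r\<^sup>*" by (rule rtrancl_trans)
    qed simp
    fix v assume v: "v \<in> verts R' \<inter> C"
    show "deg R' v = 1"
    proof (cases "v \<in> verts R")
      case True
      then have "v \<notin> {y, z}" using v y z by blast
      then have "{e \<in> edges R'. v \<in> e} = {e \<in> edges R. v \<in> e}" by auto
      then show ?thesis using leaf[OF True] v unfolding deg_def by simp
    next
      case False
      then have "v = z" using v by simp
      then have "{e \<in> edges R'. v \<in> e} = {{y, z}}" using False sub by (auto simp: subgraph_def)
      then show ?thesis unfolding deg_def by simp
    qed
  qed
  ultimately have "R' = R" using T unfolding trunk_def by blast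
  then have "verts R' = verts R" "edges R' = edges R" by simp_all
  then show ?thesis by auto
qed

text \<open>In a forest the excluded case is also fine: a walk inside the trunk joins
  \<open>y\<close> to the only trunk neighbour \<open>y'\<close> of \<open>b\<close> while avoiding
  \<open>b\<close>, which forces \<open>y = y'\<close>.\<close>

lemma forest_trunk_closed:
  assumes F: "forest F" and T: "trunk F {b} R" and y: "y \<in> verts R" "y \<noteq> b" and yz: "adj F y z"
  shows "z \<in> verts R \<and> {y, z} \<in> edges R"
proof (cases "z = b \<and> b \<in> verts R")
  case False
  then show ?thesis
    using trunk_closed[OF T y(1) _ yz] y(2) adj_verts(2)[OF _ yz] F by (auto simp: forest_def)
next
  case True
  have sub: "subgraph R F" and conn: "connected R" and leaf: "deg R b = 1"
    using T True by (auto simp: trunk_def trunk_cond_def)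
  obtain e where e: "{e \<in> edges R. b \<in> e} = {e}"
    using leaf unfolding deg_def by (metis card_1_singletonE)
  then have "e \<in> edges F" "b \<in> e" using sub by (auto simp: subgraph_def)
  then obtain y' where y': "e = {b, y'}" "b \<noteq> y'"
    using F unfolding forest_def graph_def by (metis insertE insert_commute singletonD)
  have eR: "e \<in> edges R" using e by blast
  have nb: "w = y'" if "adj R b w" for w
  proof -
    have "{b, w} \<in> {e \<in> edges R. b \<in> e}" using that by (simp add: adj_def)
    then have "{b, w} = e" unfolding e by simp
    then show ?thesis using y' by (auto simp: doubleton_eq_iff)
  qed
  let ?r = "\<lambda>x y. adj F x y \<and> x \<noteq> b \<and> y \<noteq> b"
  have yb: "(y, b) \<in> {(u, v). adj R u v}\<^sup>*"
    using conn y True by (auto simp: connected_def)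
  \<comment> \<open>The walk can enter and leave \<open>b\<close> only through \<open>y'\<close>.
    Recording \<open>y'\<close> in place of \<open>b\<close> cuts these detours out.\<close>
  have "if w = b then ?r\<^sup>*\<^sup>* y y' else ?r\<^sup>*\<^sup>* y w"
    if "(y, w) \<in> {(u, v). adj R u v}\<^sup>*" for w
    using that
  proof (induction rule: rtrancl_induct)
    case base
    then show ?case using y by auto
  next
    case (step u w)
    have a: "adj F u w" using step(2) sub by (auto simp: adj_def subgraph_def)
    show ?case
    proof (cases "w = b")
      case True
      then have "u = y'" "u \<noteq> b" using nb[of u] step(2) adj_sym[of R u w] adj_neq[of R u w] by auto
      then show ?thesis using step(3) True by auto
    next
      case wb: False
      show ?thesis
      proof (cases "u = b")
        case True
        then show ?thesis using nb[of w] step(2,3) wb by auto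
      next
        case False
        then show ?thesis using step(3) wb a by (auto intro: rtranclp.rtrancl_into_rtrancl)
      qed
    qed
  qed
  from this[OF yb] have "y = y'"
    using forest_neighbours_separated[OF F, of b y y'] yz True adj_sym[of F y z] y' \<open>e \<in> edges F\<close>
    by (auto simp: adj_def)
  then show ?thesis using True y' eR by (auto simp: insert_commute)
qed

section \<open>The disjoint union of the trunks\<close>

lemma verts_trunk_union:
  "(R, v) \<in> verts (trunk_union G C) \<longleftrightarrow> trunk G C R \<and> v \<in> verts R"
  unfolding trunk_union_def verts_def fst_conv by blast

lemma edges_trunk_unionI:
  "trunk G C R \<Longrightarrow> u \<noteq> v \<Longrightarrow> {u, v} \<in> edges R \<Longrightarrow> {(R, u), (R, v)} \<in> edges (trunk_union G C)"
  unfolding trunk_union_def edges_def snd_conv by blast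

lemma finite_trunk_union:
  assumes "graph G"
  shows "finite (verts (trunk_union G C))" "finite (edges (trunk_union G C))"
proof -
  let ?T = "Pow (verts G) \<times> Pow (edges G)"
  have sub: "R \<in> ?T" "verts R \<subseteq> verts G" "e \<in> edges R \<Longrightarrow> e \<subseteq> verts R" if "trunk G C R" for R e
    using that unfolding trunk_def trunk_cond_def subgraph_def
    by (auto simp: mem_Times_iff verts_def edges_def)
  have "verts (trunk_union G C) \<subseteq> ?T \<times> verts G"
    using sub by (fastforce simp: trunk_union_def verts_def[of "(_, _)"])
  then show fin: "finite (verts (trunk_union G C))"
    by (rule finite_subset) (use assms graph_finite_edges[OF assms] in \<open>simp add: graph_def\<close>)
  have "edges (trunk_union G C) \<subseteq> Pow (verts (trunk_union G C))"
    using sub(3) by (fastforce simp: trunk_union_def verts_def[of "(_, _)"] edges_def[of "(_, _)"])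
  then show "finite (edges (trunk_union G C))"
    by (rule finite_subset) (use fin in simp)
qed

text \<open>Tagging vertices with \<open>t\<close> is injective on edges. This keeps high vertices
  of degree above 2 in the trunk union, in the reduced graph and in its trunks.\<close>

lemma deg_le_copy:
  assumes G: "graph G" and fin: "finite (edges H)"
    and copy: "\<And>z. adj G y z \<Longrightarrow> {(t, y), (t, z)} \<in> edges H"
  shows "deg G y \<le> deg H (t, y)"
  unfolding deg_def
proof (rule card_inj_on_le)
  show "inj_on ((`) (Pair t)) {e \<in> edges G. y \<in> e}"
    by (intro inj_onI) (simp add: inj_image_eq_iff inj_on_def)
  show "finite {e \<in> edges H. (t, y) \<in> e}" using fin by simp
  show "(`) (Pair t) ` {e \<in> edges G. y \<in> e} \<subseteq> {e \<in> edges H. (t, y) \<in> e}"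
  proof (intro image_subsetI)
    fix e assume "e \<in> {e \<in> edges G. y \<in> e}"
    then have e: "e \<in> edges G" "y \<in> e" by simp_all
    then obtain u v where uv: "e = {u, v}" "u \<noteq> v" using G unfolding graph_def by metis
    obtain z where z: "e = {y, z}" "y \<noteq> z"
    proof (cases "y = u")
      case True
      then show ?thesis using that[of v] uv by simp
    next
      case False
      then show ?thesis using that[of u] uv e(2) by auto
    qed
    then have "adj G y z" using e(1) by (simp add: adj_def)
    then show "Pair t ` e \<in> {e \<in> edges H. (t, y) \<in> e}" using copy[of z] z by simp
  qed
qed

text \<open>A component with an uncoloured high vertex embeds, tagged by a trunk \<open>T\<close> of
  \<open>F\<close>, into a single trunk \<open>R\<close> of the reduced graph. Its high edges become
  edges with both ends of degree above 2, so conditions (i) and (ii) carry over.\<close>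

lemma safe_after_first_move:
  assumes F: "forest F"
    and trunks: "\<forall>R'. trunk (reduced F {b}) (trunk_union_col F {b}) R' \<longrightarrow>
           ((card (verts R' \<inter> trunk_union_col F {b}) = 1 \<and>
             edges R' \<inter> E_ggt2 (reduced F {b}) = {})
          \<or> (verts R' \<inter> trunk_union_col F {b} = {} \<and>
             (\<exists>v\<in>verts R'. covers v (E_ggt2 R'))))"
  shows "safe F ((\<lambda>_. None)(b := Some k))"
  unfolding safe_def
proof
  fix x
  define c :: "'a coloring" where "c = (\<lambda>_. None)(b := Some k)"
  have cN: "c y = None \<longleftrightarrow> y \<noteq> b" and cS: "c y = Some j \<longleftrightarrow> y = b \<and> j = k" for y j
    by (auto simp: c_def)
  have G: "graph F" using F by (simp add: forest_def)
  have "good F c (comp F c x)"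
  proof (cases "\<exists>y\<in>comp F c x. high F y \<and> y \<noteq> b")
    case False
    then show ?thesis
      by (intro goodI) (auto simp: touch_def high_edge_def cN)
  next
    case True
    then obtain y where y: "y \<in> comp F c x" "high F y" "y \<noteq> b" by blast
    define K where "K = comp F c y"
    have K: "comp F c x = K" using comp_eq[OF y(1)] by (simp add: K_def)
    define U H C where "U = trunk_union F {b}" and "H = reduced F {b}" and "C = trunk_union_col F {b}"
    obtain T where T: "trunk F {b} T" "y \<in> verts T"
      using trunk_exists[of F y "{b}"] G graph_finite_edges[OF G] high_in_verts[OF G y(2)] y(3)
      by (auto simp: graph_def)
    have VU: "verts H = verts U" and EH: "edges H = {e \<in> edges U. \<exists>u\<in>e. deg U u > 2}"
      unfolding H_def U_def reduced_def E_gt2_def by (simp_all add: verts_def edges_def)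
    have VH: "(T, z) \<in> verts H \<longleftrightarrow> z \<in> verts T" for z
      using T(1) by (simp add: VU U_def verts_trunk_union)
    have CT: "(T, z) \<in> C \<longleftrightarrow> z \<in> verts T \<and> z = b" for z
      using T(1) unfolding C_def trunk_union_col_def by blast
    have finU: "finite (verts U)" "finite (edges U)"
      unfolding U_def by (rule finite_trunk_union[OF G])+
    have finH: "finite (edges H)" using finU(2) EH by simp
    have edge_U: "{(T, u), (T, z)} \<in> edges U" if "u \<in> verts T" "u \<noteq> b" "adj F u z" for u z
    proof -
      have "{u, z} \<in> edges T" using forest_trunk_closed[OF F T(1) that] by simp
      moreover have "u \<noteq> z" using that(3) by (rule adj_neq)
      ultimately show ?thesis
        unfolding U_def by (intro edges_trunk_unionI[OF T(1)])
    qed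
    \<comment> \<open>All edges of \<open>F\<close> at an uncoloured vertex of \<open>T\<close> are
      copied, so a high end keeps its degree and saves the edge from deletion.\<close>
    have edge_H: "{(T, u), (T, z)} \<in> edges H" if "u \<in> verts T" "u \<noteq> b" "adj F u z" "high F u" for u z
    proof -
      have "deg U (T, u) > 2"
        using deg_le_copy[OF G finU(2) edge_U[OF that(1,2)]] that(4) by (simp add: high_def)
      then show ?thesis using edge_U[OF that(1-3)] EH by auto
    qed
    have deg_H: "deg H (T, u) > 2" if "u \<in> verts T" "u \<noteq> b" "high F u" for u
      using deg_le_copy[OF G finH edge_H[OF that(1,2) _ that(3)]] that(3) by (simp add: high_def)
    obtain R where R: "trunk H C R" "(T, y) \<in> verts R"
      using trunk_exists[of H "(T, y)" C] finU finH T(2) VU VH CT y(3) by auto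
    have finR: "finite (edges R)"
      using R(1) finite_subset[OF _ finH] by (auto simp: trunk_def trunk_cond_def subgraph_def)
    \<comment> \<open>The side condition on \<open>z = b\<close> is the one of
      \<open>trunk_closed\<close>. When the copy of \<open>b\<close> is absent from
      \<open>R\<close>, it also yields that no high vertex of \<open>K\<close> is adjacent to
      \<open>b\<close>.\<close>
    have closed: "z \<in> verts T \<and> (T, z) \<in> verts R \<and> {(T, u), (T, z)} \<in> edges R"
      if u: "u \<in> verts T" "(T, u) \<in> verts R" "u \<noteq> b" and uz: "adj F u z"
        and hi: "high F u \<or> z \<noteq> b \<and> high F z" and zR: "z \<noteq> b \<or> (T, b) \<notin> verts R" for u z
    proof -
      have z: "z \<in> verts T" using forest_trunk_closed[OF F T(1) u(1,3) uz] by simp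
      have "{(T, u), (T, z)} \<in> edges H"
        using hi edge_H[OF u(1,3) uz] edge_H[OF z _ adj_sym[OF uz]] by (auto simp: insert_commute)
      then have "adj H (T, u) (T, z)" using adj_neq[OF uz] by (simp add: adj_def)
      then show ?thesis
        using trunk_closed[OF R(1) u(2), of "(T, z)"] u(3) zR z VH CT by auto
    qed
    have inR: "z \<in> verts T \<and> (T, z) \<in> verts R \<and> z \<noteq> b" if "z \<in> K" for z
    proof -
      have "(link F c)\<^sup>*\<^sup>* y z" using that by (simp add: K_def comp_def)
      then show ?thesis
      proof (induction rule: rtranclp_induct)
        case base
        then show ?case using T(2) R(2) y(3) by simp
      next
        case (step u z)
        then show ?case using closed[of u z] by (auto simp: link_def cN)
      qed
    qed
    have edge_R: "{(T, u), (T, w)} \<in> edges R" if "u \<in> K" "high_edge F c u w" for u w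
      using closed[of u w] inR[OF that(1)] that(2) by (auto simp: high_edge_def cN)
    have touchD: "adj F u b \<and> high F u \<and> j = k" if "touch F c u j" for u j
      using that adj_sym[of F b u] by (auto simp: touch_def cS)
    have "(card (verts R \<inter> C) = 1 \<and> edges R \<inter> E_ggt2 H = {}) \<or>
        (verts R \<inter> C = {} \<and> (\<exists>v\<in>verts R. covers v (E_ggt2 R)))"
      using trunks R(1) unfolding H_def C_def by blast
    then have "good F c K"
    proof (elim disjE conjE)
      assume none: "edges R \<inter> E_ggt2 H = {}"
      have sub: "edges R \<subseteq> edges H"
        using R(1) by (auto simp: trunk_def trunk_cond_def subgraph_def)
      have no: "\<not> high_edge F c u w" if "u \<in> K" "w \<in> K" for u w
      proof
        assume uw: "high_edge F c u w"
        then have "{(T, u), (T, w)} \<in> E_ggt2 H"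
          using edge_R[OF that(1) uw] sub deg_H[of u] deg_H[of w] inR[OF that(1)] inR[OF that(2)]
          by (auto simp: E_ggt2_def high_edge_def)
        with edge_R[OF that(1) uw] none show False by blast
      qed
      show ?thesis
      proof (cases "\<exists>u\<in>K. \<exists>j. touch F c u j")
        case True
        then obtain v where v: "v \<in> K" "adj F b v" using touchD adj_sym by metis
        show ?thesis
        \<comment> \<open>Only \<open>b\<close> is coloured, and by acyclicity it has at most one
          neighbour in \<open>K\<close>.\<close>
        proof (rule goodI[where v = v and a = k, OF _ no])
          fix u j assume u: "u \<in> K" "touch F c u j"
          then have "adj F b u" "j = k" using touchD adj_sym by metis+
          then show "u = v \<and> j = k"
            using comp_update_neighbour_unique[OF F, of u "\<lambda>_. None" b k y v] u(1) v
            unfolding K_def c_def by blast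
        qed
      next
        case False
        then show ?thesis by (intro goodI[OF _ no]) auto
      qed
    next
      assume uncol: "verts R \<inter> C = {}" and "\<exists>v\<in>verts R. covers v (E_ggt2 R)"
      then obtain v where v: "covers v (E_ggt2 R)" by blast
      have bR: "(T, b) \<notin> verts R"
      proof
        assume b: "(T, b) \<in> verts R"
        moreover have "verts R \<subseteq> verts H"
          using R(1) by (auto simp: trunk_def trunk_cond_def subgraph_def)
        ultimately show False using uncol VH CT by blast
      qed
      have no_b: "\<not> adj F u b" if "u \<in> K" "high F u" for u
        using closed[of u b] inR[OF that(1)] that(2) bR by blast
      \<comment> \<open>The covering condition counts degrees inside \<open>R\<close> itself, so all
        edges at \<open>u\<close> must be found there and not only in the reduced graph.\<close>
      have deg_R: "deg R (T, u) > 2" if "u \<in> K" "high F u" for u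
      proof -
        have "{(T, u), (T, z)} \<in> edges R" if "adj F u z" for z
          using closed[of u z] inR[OF \<open>u \<in> K\<close>] \<open>high F u\<close> bR that by blast
        then have "deg F u \<le> deg R (T, u)" by (rule deg_le_copy[OF G finR])
        then show ?thesis using that(2) by (simp add: high_def)
      qed
      show ?thesis
      proof (rule goodI2[where v = "snd v"])
        show "\<not> touch F c u j" if "u \<in> K" for u j
          using no_b[OF that] touchD by blast
        show "u = snd v \<or> w = snd v" if "u \<in> K" "w \<in> K" "high_edge F c u w" for u w
        proof -
          have "{(T, u), (T, w)} \<in> E_ggt2 R"
            using edge_R[OF that(1,3)] deg_R that by (auto simp: E_ggt2_def high_edge_def)
          with v show ?thesis unfolding covers_def by auto
        qed
      qed
    qed
    with K show ?thesis by simp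
  qed
  then show "good F ((\<lambda>_. None)(b := Some k)) (comp F ((\<lambda>_. None)(b := Some k)) x)"
    by (simp add: c_def)
qed

theorem theorem6p3:
  fixes F :: "'a graph" and b :: 'a
  assumes "forest F"
    and "b \<in> verts F"
    and "\<forall>R'. trunk (reduced F {b}) (trunk_union_col F {b}) R' \<longrightarrow>
           ((card (verts R' \<inter> trunk_union_col F {b}) = 1 \<and>
             edges R' \<inter> E_ggt2 (reduced F {b}) = {})
          \<or> (verts R' \<inter> trunk_union_col F {b} = {} \<and>
             (\<exists>v\<in>verts R'. covers v (E_ggt2 R'))))"
  shows "game_chromatic_number F \<le> 3"
proof -
  have "alice_wins F 3"
    unfolding alice_wins_def
  proof (rule alice)
    show "\<not> all_colored F (\<lambda>_. None)" using assms(2) by (auto simp: all_colored_def)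
    show "\<not> blocked F 3 (\<lambda>_. None)" by (auto simp: blocked_def intro: exI[of _ 0])
    \<comment> \<open>Colour 0 is an arbitrary choice: the trunk condition depends only on which
      vertex is coloured.\<close>
    show "legal_move F 3 (\<lambda>_. None) b 0" using assms(2) by (simp add: legal_move_def)
    show "alice_wins_from F 3 ((\<lambda>_. None)(b := Some 0)) False"
      by (rule safe_alice_wins[OF assms(1) safe_after_first_move[OF assms(1,3)]])
  qed
  then show ?thesis unfolding game_chromatic_number_def by (rule Least_le)
qed

end
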